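(* Work in a structure admitting all definable finite power sets. Let $X,Y$ be definable sets and let $\mathcal F(X)$ be a definable finite power set of $X$. Given $y_0\in Y$, a definable function $g:X\to Y$ and a commutative and associative definable function $h:Y\times Y\to Y$, there is a unique definable function $G:\mathcal F(X)\to Y$ such that for all $A\in\mathcal F(X)$ and $x\in X$ we have: (1) $G(\emptyset^* )=y_0$; (2) $G(A\cup^*\{x\}^* )=h(G(A),g(x))$. Moreover, the definition of $G$ depends uniformly on the parameters of $y_0,g,h$.
   Context: "Definable" means first-order definable with parameters. Let $X,Z$ be definable sets in a structure and let $\in^*$ be a definable relation between $X$ and $Z$. $Z$ is a definable finite power set of $X$ with respect to $\in^*$ (and one writes $\mathcal F(X)=Z$) if: (i) $B,C\in\mathcal F(X)$ are equal iff for all $x\in X$, $x\in^* B\iff x\in^* C$; (ii) there is $\emptyset^*\in\mathcal F(X)$ with $x\notin^*\emptyset^*$ for all $x\in X$; (iii) for each $a\in X$ there is $\{a\}^*\in\mathcal F(X)$ such that for all $x\in X$, $x\in^*\{a\}^*\iff x=a$; (iv) for all $B,C\in\mathcal F(X)$ there is $B\cup^*C\in\mathcal F(X)$ such that for all $x\in X$, $x\in^* B\cup^* C\iff x\in^*B\lor x\in^*C$; (v) every definable $\mathcal U\subseteq\mathcal F(X)$ such that $\emptyset^*\in\mathcal U$ and $B\cup^*\{x\}^*\in\mathcal U$ for all $B\in\mathcal U$ and $x\in X$ equals $\mathcal F(X)$. By (i), the elements $\emptyset^*$, $\{a\}^*$, $B\cup^*C$ are uniquely determined. A structure $\mathcal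 A$ admits all definable finite power sets if every definable set $X$ in $\mathcal A$ has a definable finite power set $\mathcal F(X)$.
   Formalization: Equation (2) is required only for x not in* A; as printed, for all x in X, it fails, e.g. over the structure {0,1} with X={0}, Y={0,1}, h addition mod 2, g(0)=1, y_0=0. *)

theory Defs
  imports Main "HOL-Library.FuncSet"
begin

section \<open>First-order structures and definable sets\<close>

text \<open>Variables are de Bruijn indices: under a quantifier, index 0 is the bound variable and
  index \<open>Suc i\<close> is the variable \<open>i\<close> of the surrounding formula.\<close>

datatype 'f trm = Var nat | Fn 'f "'f trm list"

datatype ('f, 'r) fm =
    Eq "'f trm" "'f trm"
  | Rel 'r "'f trm list"
  | Neg "('f, 'r) fm"
  | Conj "('f, 'r) fm" "('f, 'r) fm"
  | Ex "('f, 'r) fm"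

text \<open>The universe is the whole (nonempty) type \<open>'a\<close>. The arities are partial so that the language
  may be any, possibly empty, part of the symbols in \<open>'f\<close> and \<open>'r\<close>; the interpretation
  of a symbol matters only on argument lists whose length is its arity.\<close>

record ('f, 'r, 'a) fo_structure =
  fn_arity :: "'f \<Rightarrow> nat option"
  rel_arity :: "'r \<Rightarrow> nat option"
  fn_interp :: "'f \<Rightarrow> 'a list \<Rightarrow> 'a"
  rel_interp :: "'r \<Rightarrow> 'a list \<Rightarrow> bool"

primrec wf_trm :: "('f, 'r, 'a) fo_structure \<Rightarrow> 'f trm \<Rightarrow> bool" where
  "wf_trm M (Var i) \<longleftrightarrow> True"
| "wf_trm M (Fn f ts) \<longleftrightarrow> fn_arity M f = Some (length ts) \<and> list_all id (map (wf_trm M) ts)"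

primrec wf_fm :: "('f, 'r, 'a) fo_structure \<Rightarrow> ('f, 'r) fm \<Rightarrow> bool" where
  "wf_fm M (Eq s t) \<longleftrightarrow> wf_trm M s \<and> wf_trm M t"
| "wf_fm M (Rel r ts) \<longleftrightarrow> rel_arity M r = Some (length ts) \<and> list_all (wf_trm M) ts"
| "wf_fm M (Neg p) \<longleftrightarrow> wf_fm M p"
| "wf_fm M (Conj p q) \<longleftrightarrow> wf_fm M p \<and> wf_fm M q"
| "wf_fm M (Ex p) \<longleftrightarrow> wf_fm M p"

primrec fv_trm :: "'f trm \<Rightarrow> nat set" where
  "fv_trm (Var i) = {i}"
| "fv_trm (Fn f ts) = \<Union> (set (map fv_trm ts))"

primrec fv :: "('f, 'r) fm \<Rightarrow> nat set" where
  "fv (Eq s t) = fv_trm s \<union> fv_trm t"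
| "fv (Rel r ts) = \<Union> (set (map fv_trm ts))"
| "fv (Neg p) = fv p"
| "fv (Conj p q) = fv p \<union> fv q"
| "fv (Ex p) = {i. Suc i \<in> fv p}"

primrec val :: "('f, 'r, 'a) fo_structure \<Rightarrow> (nat \<Rightarrow> 'a) \<Rightarrow> 'f trm \<Rightarrow> 'a" where
  "val M e (Var i) = e i"
| "val M e (Fn f ts) = fn_interp M f (map (val M e) ts)"

primrec sat :: "('f, 'r, 'a) fo_structure \<Rightarrow> (nat \<Rightarrow> 'a) \<Rightarrow> ('f, 'r) fm \<Rightarrow> bool" where
  "sat M e (Eq s t) \<longleftrightarrow> val M e s = val M e t"
| "sat M e (Rel r ts) \<longleftrightarrow> rel_interp M r (map (val M e) ts)"
| "sat M e (Neg p) \<longleftrightarrow> \<not> sat M e p"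
| "sat M e (Conj p q) \<longleftrightarrow> sat M e p \<and> sat M e q"
| "sat M e (Ex p) \<longleftrightarrow> (\<exists>a. sat M (case_nat a e) p)"

text \<open>\<open>defined_by M \<phi> ps n D\<close>: \<open>D\<close> is the subset of the \<open>n\<close>-th Cartesian power of the universe
  (tuples are lists of length \<open>n\<close>) defined by \<open>\<phi>\<close> with the parameter tuple \<open>ps\<close>. The
  variables \<open>0, \<dots>, n - 1\<close> are the coordinates and the next \<open>length ps\<close> variables stand for the
  parameters.\<close>

definition defined_by ::
    "('f, 'r, 'a) fo_structure \<Rightarrow> ('f, 'r) fm \<Rightarrow> 'a list \<Rightarrow> nat \<Rightarrow> 'a list set \<Rightarrow> bool" where
  "defined_by M \<phi> ps n D \<longleftrightarrow>
     wf_fm M \<phi> \<and> fv \<phi> \<subseteq> {..<n + length ps} \<and>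
     D = {xs. length xs = n \<and> sat M (nth (xs @ ps)) \<phi>}"

definition definable :: "('f, 'r, 'a) fo_structure \<Rightarrow> nat \<Rightarrow> 'a list set \<Rightarrow> bool" where
  "definable M n D \<longleftrightarrow> (\<exists>\<phi> ps. defined_by M \<phi> ps n D)"

text \<open>Relations and functions between definable sets are identified with their graphs, where a
  pair of tuples is their concatenation.\<close>

definition rel_graph ::
    "'a list set \<Rightarrow> 'a list set \<Rightarrow> ('a list \<Rightarrow> 'a list \<Rightarrow> bool) \<Rightarrow> 'a list set" where
  "rel_graph X Z R = {x @ z | x z. x \<in> X \<and> z \<in> Z \<and> R x z}"

definition fun_graph :: "'a list set \<Rightarrow> ('a list \<Rightarrow> 'a list) \<Rightarrow> 'a list set" where
  "fun_graph X g = {x @ g x | x. x \<in> X}"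

definition op_graph :: "'a list set \<Rightarrow> ('a list \<Rightarrow> 'a list \<Rightarrow> 'a list) \<Rightarrow> 'a list set" where
  "op_graph Y h = {u @ v @ h u v | u v. u \<in> Y \<and> v \<in> Y}"


section \<open>Definable finite power sets\<close>

text \<open>In the following \<open>E x B\<close> is the relation \<open>x \<in>\<^sup>* B\<close> between \<open>X\<close> and \<open>Z\<close>.\<close>

definition is_empty_code ::
    "'a list set \<Rightarrow> 'a list set \<Rightarrow> ('a list \<Rightarrow> 'a list \<Rightarrow> bool) \<Rightarrow> 'a list \<Rightarrow> bool" where
  "is_empty_code X Z E B \<longleftrightarrow> B \<in> Z \<and> (\<forall>x\<in>X. \<not> E x B)"

definition is_single_code ::
    "'a list set \<Rightarrow> 'a list set \<Rightarrow> ('a list \<Rightarrow> 'a list \<Rightarrow> bool) \<Rightarrow> 'a list \<Rightarrow> 'a list \<Rightarrow> bool" where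
  "is_single_code X Z E a B \<longleftrightarrow> B \<in> Z \<and> (\<forall>x\<in>X. E x B \<longleftrightarrow> x = a)"

definition is_union_code ::
    "'a list set \<Rightarrow> 'a list set \<Rightarrow> ('a list \<Rightarrow> 'a list \<Rightarrow> bool) \<Rightarrow>
     'a list \<Rightarrow> 'a list \<Rightarrow> 'a list \<Rightarrow> bool" where
  "is_union_code X Z E B C D \<longleftrightarrow> D \<in> Z \<and> (\<forall>x\<in>X. E x D \<longleftrightarrow> E x B \<or> E x C)"

text \<open>The descriptions below are used only where extensionality (first clause after definability in
  \<open>finite_power_set\<close>) makes the described element unique.\<close>

definition empty_code ::
    "'a list set \<Rightarrow> 'a list set \<Rightarrow> ('a list \<Rightarrow> 'a list \<Rightarrow> bool) \<Rightarrow> 'a list" where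
  "empty_code X Z E = (THE B. is_empty_code X Z E B)"

definition single_code ::
    "'a list set \<Rightarrow> 'a list set \<Rightarrow> ('a list \<Rightarrow> 'a list \<Rightarrow> bool) \<Rightarrow> 'a list \<Rightarrow> 'a list" where
  "single_code X Z E a = (THE B. is_single_code X Z E a B)"

definition union_code ::
    "'a list set \<Rightarrow> 'a list set \<Rightarrow> ('a list \<Rightarrow> 'a list \<Rightarrow> bool) \<Rightarrow>
     'a list \<Rightarrow> 'a list \<Rightarrow> 'a list" where
  "union_code X Z E B C = (THE D. is_union_code X Z E B C D)"

definition finite_power_set ::
    "('f, 'r, 'a) fo_structure \<Rightarrow> nat \<Rightarrow> 'a list set \<Rightarrow> nat \<Rightarrow> 'a list set \<Rightarrow>
     ('a list \<Rightarrow> 'a list \<Rightarrow> bool) \<Rightarrow> bool" where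
  "finite_power_set M n X k Z E \<longleftrightarrow>
     definable M n X \<and> definable M k Z \<and> definable M (n + k) (rel_graph X Z E) \<and>
     (\<forall>B\<in>Z. \<forall>C\<in>Z. B = C \<longleftrightarrow> (\<forall>x\<in>X. E x B \<longleftrightarrow> E x C)) \<and>
     (\<exists>B. is_empty_code X Z E B) \<and>
     (\<forall>a\<in>X. \<exists>B. is_single_code X Z E a B) \<and>
     (\<forall>B\<in>Z. \<forall>C\<in>Z. \<exists>D. is_union_code X Z E B C D) \<and>
     (\<forall>U. definable M k U \<and> U \<subseteq> Z \<and> empty_code X Z E \<in> U \<and>
          (\<forall>B\<in>U. \<forall>x\<in>X. union_code X Z E B (single_code X Z E x) \<in> U)
        \<longrightarrow> U = Z)"

definition admits_finite_power_sets :: "('f, 'r, 'a) fo_structure \<Rightarrow> bool" where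
  "admits_finite_power_sets M \<longleftrightarrow>
     (\<forall>n X. definable M n X \<longrightarrow> (\<exists>k Z E. finite_power_set M n X k Z E))"


section \<open>Recursion along a definable finite power set\<close>

definition comm_assoc_on :: "'a list set \<Rightarrow> ('a list \<Rightarrow> 'a list \<Rightarrow> 'a list) \<Rightarrow> bool" where
  "comm_assoc_on Y h \<longleftrightarrow>
     (\<forall>u\<in>Y. \<forall>v\<in>Y. h u v = h v u) \<and>
     (\<forall>u\<in>Y. \<forall>v\<in>Y. \<forall>w\<in>Y. h (h u v) w = h u (h v w))"

text \<open>A function on \<open>Z\<close> is represented by its extensional HOL function, so that uniqueness
  in HOL is uniqueness as a function on \<open>Z\<close>.

  The recursion equation is required for \<open>x \<notin>\<^sup>* A\<close> only. For \<open>x \<in>\<^sup>* A\<close> the argument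
  \<open>A \<union>\<^sup>* {x}\<^sup>*\<close> is \<open>A\<close> itself, and the equation would read \<open>G A = h (G A) (g x)\<close>, which
  fails unless \<open>h\<close> has some idempotency: for \<open>X = {a}\<close>, \<open>Y = {0, 1}\<close>, \<open>h\<close> addition modulo 2,
  \<open>g a = 1\<close> and \<open>y0 = 0\<close> it has no solution.\<close>

definition recursive_solution ::
    "('f, 'r, 'a) fo_structure \<Rightarrow> 'a list set \<Rightarrow> nat \<Rightarrow> 'a list set \<Rightarrow>
     ('a list \<Rightarrow> 'a list \<Rightarrow> bool) \<Rightarrow> nat \<Rightarrow> 'a list set \<Rightarrow> 'a list \<Rightarrow> ('a list \<Rightarrow> 'a list) \<Rightarrow>
     ('a list \<Rightarrow> 'a list \<Rightarrow> 'a list) \<Rightarrow> ('a list \<Rightarrow> 'a list) \<Rightarrow> bool" where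
  "recursive_solution M X k Z E m Y y0 g h G \<longleftrightarrow>
     G \<in> Z \<rightarrow>\<^sub>E Y \<and> definable M (k + m) (fun_graph Z G) \<and>
     G (empty_code X Z E) = y0 \<and>
     (\<forall>A\<in>Z. \<forall>x\<in>X. \<not> E x A \<longrightarrow>
        G (union_code X Z E A (single_code X Z E x)) = h (G A) (g x))"

end

theory Submission imports Defs begin

text \<open>Inside the structure there are no natural numbers, so the recursion cannot be run step by
  step. Instead a value is certified by a derivation: a set of pairs \<open>(A, y)\<close> with
  \<open>A \<in> \<F>(X)\<close> and \<open>y \<in> Y\<close>, finite in the sense of the structure, in which every pair is either \<open>(\<emptyset>\<^sup>*, y\<^sub>0)\<close> or has the form
  \<open>(B \<union>\<^sup>* {x}\<^sup>*, h(u, g(x)))\<close> with \<open>x \<notin>\<^sup>* B\<close> and \<open>(B, u)\<close> in the same set. Derivations are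
  elements of a definable finite power set of \<open>\<F>(X) \<times> Y\<close>, so ``\<open>A\<close> has derivable value \<open>y\<close>'' is
  first-order, by a formula into which \<open>y\<^sub>0\<close> and the parameters of \<open>g\<close> and \<open>h\<close> enter as variables;
  this is the uniform definition of \<open>G\<close>.

  Every \<open>A\<close> has a derivable value by induction on \<open>A\<close>: a derivation is extended by one pair.
  That the value is unique is where commutativity and associativity enter
  (\<open>recursion_functional\<close>). If the last steps of two derivations for \<open>A\<close> remove different elements
  \<open>x\<close> and \<open>x'\<close>, let \<open>C\<close> be \<open>A\<close> without both and \<open>v\<close> a derivable value of \<open>C\<close>. The two
  predecessors of \<open>A\<close> are \<open>C \<union>\<^sup>* {x'}\<^sup>*\<close> and \<open>C \<union>\<^sup>* {x}\<^sup>*\<close>; by induction their only values are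
  \<open>h(v, g(x'))\<close> and \<open>h(v, g(x))\<close>, and applying the missing element gives the same result in both
  orders. The argument uses the induction hypothesis for several predecessors of \<open>A\<close> at once, so it
  needs an induction over all proper subsets; \<open>strong_induct\<close> derives it from the
  one-element-at-a-time axiom.

  All inductions are over definable families only. Definability is therefore treated as a property
  \<open>dfn\<close> of predicates on variable assignments which is closed under the logical connectives and
  under quantification over definable sets, so that each definability proof follows the shape of
  the predicate.\<close>

section \<open>Renaming the variables of a formula\<close>

primrec ren_trm :: "(nat \<Rightarrow> nat) \<Rightarrow> 'f trm \<Rightarrow> 'f trm" where
  "ren_trm r (Var i) = Var (r i)"
| "ren_trm r (Fn f ts) = Fn f (map (ren_trm r) ts)"

primrec ren_fm :: "(nat \<Rightarrow> nat) \<Rightarrow> ('f, 'r) fm \<Rightarrow> ('f, 'r) fm" where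
  "ren_fm r (Eq s t) = Eq (ren_trm r s) (ren_trm r t)"
| "ren_fm r (Rel q ts) = Rel q (map (ren_trm r) ts)"
| "ren_fm r (Neg p) = Neg (ren_fm r p)"
| "ren_fm r (Conj p q) = Conj (ren_fm r p) (ren_fm r q)"
| "ren_fm r (Ex p) = Ex (ren_fm (case_nat 0 (\<lambda>i. Suc (r i))) p)"

lemma val_ren: "val M e (ren_trm r t) = val M (e \<circ> r) t"
proof (induction t)
  case (Fn f ts)
  then have "map (val M e) (map (ren_trm r) ts) = map (val M (e \<circ> r)) ts"
    by (simp add: comp_def)
  then show ?case by (simp only: val.simps ren_trm.simps)
qed simp

lemma sat_ren: "sat M e (ren_fm r \<phi>) = sat M (e \<circ> r) \<phi>"
proof (induction \<phi> arbitrary: e r)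
  case (Rel q ts)
  show ?case by (simp add: val_ren comp_def)
next
  case (Ex p)
  have "case_nat a e \<circ> case_nat 0 (\<lambda>i. Suc (r i)) = case_nat a (e \<circ> r)" for a
    by (auto simp: fun_eq_iff split: nat.split)
  then show ?case by (simp only: sat.simps ren_fm.simps Ex)
qed (simp_all add: val_ren)

lemma wf_ren_trm: "wf_trm M (ren_trm r t) = wf_trm M t"
  by (induction t) (simp_all add: list.pred_map comp_def list_all_iff)

lemma wf_ren: "wf_fm M (ren_fm r \<phi>) = wf_fm M \<phi>"
  by (induction \<phi> arbitrary: r) (simp_all add: wf_ren_trm list.pred_map comp_def)

lemma fv_ren_trm: "fv_trm (ren_trm r t) = r ` fv_trm t"
  by (induction t) auto

lemma fv_ren: "fv (ren_fm r \<phi>) = r ` fv \<phi>"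
proof (induction \<phi> arbitrary: r)
  case (Ex p)
  show ?case
  proof (intro equalityI subsetI)
    fix i
    assume "i \<in> fv (ren_fm r (Ex p))"
    then obtain j where j: "j \<in> fv p" "Suc i = case_nat 0 (\<lambda>i. Suc (r i)) j"
      unfolding ren_fm.simps fv.simps Ex by (elim CollectE imageE)
    then show "i \<in> r ` fv (Ex p)" by (cases j) simp_all
  next
    fix i
    assume "i \<in> r ` fv (Ex p)"
    then obtain j where "Suc j \<in> fv p" "i = r j"
      unfolding fv.simps by (elim CollectE imageE)
    then show "i \<in> fv (ren_fm r (Ex p))"
      unfolding ren_fm.simps fv.simps Ex by (intro CollectI image_eqI[of _ _ "Suc j"]) simp_all
  qed
qed (simp_all add: fv_ren_trm image_Un image_UN)

lemma val_cong: "(\<And>i. i \<in> fv_trm t \<Longrightarrow> e i = e' i) \<Longrightarrow> val M e t = val M e' t"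
proof (induction t)
  case (Fn f ts)
  have "map (val M e) ts = map (val M e') ts"
  proof (rule map_cong[OF refl])
    fix t
    assume t: "t \<in> set ts"
    show "val M e t = val M e' t"
      by (rule Fn.IH[OF t], rule Fn.prems) (use t in auto)
  qed
  then show ?case by (simp only: val.simps)
qed simp

lemma sat_cong: "(\<And>i. i \<in> fv \<phi> \<Longrightarrow> e i = e' i) \<Longrightarrow> sat M e \<phi> = sat M e' \<phi>"
proof (induction \<phi> arbitrary: e e')
  case (Eq s t)
  then show ?case using val_cong[of s e e' M] val_cong[of t e e' M] by simp
next
  case (Rel q ts)
  have "map (val M e) ts = map (val M e') ts"
  proof (rule map_cong[OF refl])
    fix t
    assume t: "t \<in> set ts"
    show "val M e t = val M e' t"
      by (rule val_cong, rule Rel.prems) (use t in auto)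
  qed
  then show ?case by (simp only: sat.simps)
next
  case (Conj p q)
  show ?case using Conj.IH[of e e'] Conj.prems by auto
next
  case (Neg p)
  show ?case using Neg.IH[of e e'] Neg.prems by auto
next
  case (Ex p)
  have "sat M (case_nat a e) p = sat M (case_nat a e') p" for a
    by (rule Ex.IH) (use Ex.prems in \<open>auto split: nat.split\<close>)
  then show ?case by simp
qed

section \<open>Definable predicates on assignments\<close>

text \<open>Tuple variables are blocks of consecutive variables of an assignment. The layout follows the
  de Bruijn convention: a newly quantified tuple is prepended, which moves every older block up by
  its length (\<open>block_shift\<close>).\<close>

definition prepend :: "'a list \<Rightarrow> (nat \<Rightarrow> 'a) \<Rightarrow> nat \<Rightarrow> 'a" where
  "prepend xs e i = (if i < length xs then xs ! i else e (i - length xs))"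

definition block :: "nat \<Rightarrow> nat \<Rightarrow> (nat \<Rightarrow> 'a) \<Rightarrow> 'a list" where
  "block i j e = map e [i..<i + j]"

lemma length_block [simp]: "length (block i j e) = j"
  by (simp add: block_def)

lemma nth_block [simp]: "v < j \<Longrightarrow> block i j e ! v = e (i + v)"
  by (simp add: block_def)

lemma block_eqI: "length xs = j \<Longrightarrow> (\<And>v. v < j \<Longrightarrow> e (i + v) = xs ! v) \<Longrightarrow> block i j e = xs"
  by (rule nth_equalityI) simp_all

lemma block_shift: "block i j (\<lambda>v. e (v + s)) = block (i + s) j e"
  by (rule block_eqI) (simp_all add: add.commute add.left_commute)

lemma prepend_append: "prepend (xs @ ys) e = prepend xs (prepend ys e)"
  by (rule ext) (simp add: prepend_def nth_append less_diff_conv2 diff_diff_left)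

lemma prepend_Nil [simp]: "prepend [] e = e"
  by (rule ext) (simp add: prepend_def)

lemma prepend_Cons: "prepend (a # xs) e = case_nat a (prepend xs e)"
  by (rule ext) (simp add: prepend_def split: nat.split)

lemma block_prepend_0: "length xs = j \<Longrightarrow> block 0 j (prepend xs e) = xs"
  by (rule block_eqI) (simp_all add: prepend_def)

lemma block_prepend_skip: "length xs \<le> i \<Longrightarrow> block i j (prepend xs e) = block (i - length xs) j e"
  by (rule block_eqI) (simp_all add: prepend_def)

lemma prepend_shift: "length xs = s \<Longrightarrow> (\<lambda>v. prepend xs e (v + s)) = e"
  by (rule ext) (simp add: prepend_def)

text \<open>Definability of a predicate on assignments by a formula with parameters from \<open>S\<close>. The parameters
  are hidden in front of the assignment, so that the predicate may mention them as constants. There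
  is no bound on the free variables: a predicate that depends on the first \<open>N\<close> variables only gets a
  formula in these variables in \<open>dfn_imp_formula\<close>. The choice \<open>S = UNIV\<close> gives plain definability
  with parameters; \<open>S = set es\<close> keeps track of a parameter list that is fixed in advance, as
  uniformity requires.\<close>

definition dfn ::
    "('f, 'r, 'a) fo_structure \<Rightarrow> 'a set \<Rightarrow> ((nat \<Rightarrow> 'a) \<Rightarrow> bool) \<Rightarrow> bool" where
  "dfn M S P \<longleftrightarrow>
     (\<exists>\<phi> cs. wf_fm M \<phi> \<and> set cs \<subseteq> S \<and> (\<forall>e. sat M (prepend cs e) \<phi> \<longleftrightarrow> P e))"

lemma dfnI: "wf_fm M \<phi> \<Longrightarrow> set cs \<subseteq> S \<Longrightarrow> (\<And>e. sat M (prepend cs e) \<phi> \<longleftrightarrow> P e) \<Longrightarrow> dfn M S P"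
  unfolding dfn_def by blast

lemma dfn_mono: "dfn M S P \<Longrightarrow> S \<subseteq> T \<Longrightarrow> dfn M T P"
  unfolding dfn_def by blast

text \<open>Two formulas can be combined only over a common parameter list; the variables of a formula are
  redirected to the positions that its parameters have in a longer list.\<close>

lemma sat_reparam:
  assumes "set cs \<subseteq> set ds" "wf_fm M \<phi>"
  obtains \<psi> where "wf_fm M \<psi>" "\<And>e. sat M (prepend ds e) \<psi> \<longleftrightarrow> sat M (prepend cs e) \<phi>"
proof -
  have "\<exists>j<length ds. ds ! j = cs ! i" if "i < length cs" for i
    using assms(1) that by (metis in_set_conv_nth nth_mem subsetD)
  then obtain f where f: "\<And>i. i < length cs \<Longrightarrow> f i < length ds \<and> ds ! f i = cs ! i"
    by metis
  let ?r = "\<lambda>i. if i < length cs then f i else i - length cs + length ds"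
  have "prepend ds e \<circ> ?r = prepend cs e" for e
    using f by (auto simp: prepend_def fun_eq_iff)
  then show thesis
    using that[of "ren_fm ?r \<phi>"] assms(2) by (simp add: wf_ren sat_ren)
qed

lemma dfn_neg:
  assumes "dfn M S P"
  shows "dfn M S (\<lambda>e. \<not> P e)"
proof -
  obtain \<phi> cs where 1: "wf_fm M \<phi>" "set cs \<subseteq> S" "\<And>e. sat M (prepend cs e) \<phi> \<longleftrightarrow> P e"
    using assms unfolding dfn_def by blast
  show ?thesis by (rule dfnI[of M "Neg \<phi>" cs]) (use 1 in auto)
qed

lemma dfn_conj:
  assumes "dfn M S P" "dfn M S Q"
  shows "dfn M S (\<lambda>e. P e \<and> Q e)"
proof -
  obtain \<phi> cs where 1: "wf_fm M \<phi>" "set cs \<subseteq> S" "\<And>e. sat M (prepend cs e) \<phi> \<longleftrightarrow> P e"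
    using assms(1) unfolding dfn_def by blast
  obtain \<psi> ds where 2: "wf_fm M \<psi>" "set ds \<subseteq> S" "\<And>e. sat M (prepend ds e) \<psi> \<longleftrightarrow> Q e"
    using assms(2) unfolding dfn_def by blast
  obtain \<phi>' where 3: "wf_fm M \<phi>'" "\<And>e. sat M (prepend (cs @ ds) e) \<phi>' \<longleftrightarrow> P e"
    by (rule sat_reparam[of cs "cs @ ds" M \<phi>]) (use 1 in auto)
  obtain \<psi>' where 4: "wf_fm M \<psi>'" "\<And>e. sat M (prepend (cs @ ds) e) \<psi>' \<longleftrightarrow> Q e"
    by (rule sat_reparam[of ds "cs @ ds" M \<psi>]) (use 2 in auto)
  show ?thesis
    by (rule dfnI[of M "Conj \<phi>' \<psi>'" "cs @ ds"]) (use 1 2 3 4 in auto)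
qed

lemma dfn_imp: "dfn M S P \<Longrightarrow> dfn M S Q \<Longrightarrow> dfn M S (\<lambda>e. P e \<longrightarrow> Q e)"
  using dfn_neg[OF dfn_conj[OF _ dfn_neg]] by fastforce

lemma dfn_disj: "dfn M S P \<Longrightarrow> dfn M S Q \<Longrightarrow> dfn M S (\<lambda>e. P e \<or> Q e)"
  using dfn_imp[OF dfn_neg, of M S P Q] by (simp add: disj_imp)

lemma dfn_iff:
  assumes "dfn M S P" "dfn M S Q"
  shows "dfn M S (\<lambda>e. P e \<longleftrightarrow> Q e)"
proof -
  have "dfn M S (\<lambda>e. (P e \<longrightarrow> Q e) \<and> (Q e \<longrightarrow> P e))"
    by (intro dfn_conj dfn_imp assms)
  then show ?thesis by (simp add: iff_conv_conj_imp)
qed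

lemma dfn_ex_one:
  assumes "dfn M S P"
  shows "dfn M S (\<lambda>e. \<exists>a. P (case_nat a e))"
proof -
  obtain \<phi> cs where 1: "wf_fm M \<phi>" "set cs \<subseteq> S" "\<And>e. sat M (prepend cs e) \<phi> \<longleftrightarrow> P e"
    using assms unfolding dfn_def by blast
  let ?r = "\<lambda>i. if i < length cs then Suc i else if i = length cs then 0 else i"
  have "case_nat a (prepend cs e) \<circ> ?r = prepend cs (case_nat a e)" for a e
  proof
    fix i
    consider "i < length cs" | "i = length cs" | d where "i = Suc (length cs + d)"
      by (metis less_imp_Suc_add linorder_neqE_nat)
    then show "(case_nat a (prepend cs e) \<circ> ?r) i = prepend cs (case_nat a e) i"
      by cases (auto simp: prepend_def)
  qed
  then show ?thesis
    by (intro dfnI[of M "Ex (ren_fm ?r \<phi>)" cs]) (use 1 in \<open>simp_all add: wf_ren sat_ren\<close>)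
qed

lemma dfn_ex_prepend:
  assumes "dfn M S P"
  shows "dfn M S (\<lambda>e. \<exists>x. length x = j \<and> P (prepend x e))"
  using assms
proof (induction j arbitrary: P)
  case 0
  then show ?case by simp
next
  case (Suc j)
  have "(\<exists>x. length x = Suc j \<and> P (prepend x e)) \<longleftrightarrow>
      (\<exists>x. length x = j \<and> (\<exists>a. P (case_nat a (prepend x e))))" for e
    by (force simp: length_Suc_conv prepend_Cons)
  then show ?case using Suc.IH[OF dfn_ex_one[OF Suc.prems]] by simp
qed

text \<open>In the premise the quantified tuple is the first block and the old assignment is what remains
  after dropping it.\<close>

lemma dfn_ex:
  assumes "dfn M S (\<lambda>e. Q (\<lambda>v. e (v + j)) (block 0 j e))"
  shows "dfn M S (\<lambda>e. \<exists>x. length x = j \<and> Q e x)"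
proof -
  have "(\<exists>x. length x = j \<and> Q (\<lambda>v. prepend x e (v + j)) (block 0 j (prepend x e))) \<longleftrightarrow>
      (\<exists>x. length x = j \<and> Q e x)" for e
    by (metis prepend_shift block_prepend_0)
  then show ?thesis using dfn_ex_prepend[OF assms, of j] by simp
qed

lemma dfn_bex:
  assumes D: "\<And>x. x \<in> D \<Longrightarrow> length x = j" "\<And>i. dfn M S (\<lambda>e. block i j e \<in> D)"
    and Q: "dfn M S (\<lambda>e. Q (\<lambda>v. e (v + j)) (block 0 j e))"
  shows "dfn M S (\<lambda>e. \<exists>x\<in>D. Q e x)"
proof -
  have "dfn M S (\<lambda>e. \<exists>x. length x = j \<and> x \<in> D \<and> Q e x)"
    by (intro dfn_ex dfn_conj D Q)
  moreover have "(\<exists>x. length x = j \<and> x \<in> D \<and> Q e x) \<longleftrightarrow> (\<exists>x\<in>D. Q e x)" for e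
    using D(1) by auto
  ultimately show ?thesis by simp
qed

lemma dfn_ball:
  assumes "\<And>x. x \<in> D \<Longrightarrow> length x = j" "\<And>i. dfn M S (\<lambda>e. block i j e \<in> D)"
    and "dfn M S (\<lambda>e. Q (\<lambda>v. e (v + j)) (block 0 j e))"
  shows "dfn M S (\<lambda>e. \<forall>x\<in>D. Q e x)"
  using dfn_neg[OF dfn_bex[OF assms(1,2) dfn_neg[OF assms(3)]]] by simp

lemma dfn_all_less:
  fixes n :: nat
  shows "(\<And>i. dfn M S (P i)) \<Longrightarrow> dfn M S (\<lambda>e. \<forall>i<n. P i e)"
proof (induction n)
  case 0
  show ?case by (rule dfnI[of M "Eq (Var 0) (Var 0)" "[]"]) auto
next
  case (Suc n)
  then show ?case
    using dfn_conj[OF Suc.IH Suc.prems, of n] by (simp add: All_less_Suc conj_commute)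
qed

lemma dfn_block_eq: "dfn M S (\<lambda>e. block i n e = block j n e)"
proof -
  have "dfn M S (\<lambda>e. e i = e j)" for i j
    by (rule dfnI[of M "Eq (Var i) (Var j)" "[]"]) auto
  then have "dfn M S (\<lambda>e. \<forall>v<n. e (i + v) = e (j + v))"
    by (intro dfn_all_less)
  then show ?thesis by (simp add: block_def list_eq_iff_nth_eq)
qed

lemma dfn_sat:
  assumes "wf_fm M \<phi>" "fv \<phi> \<subseteq> {..<length is + length ps}" "set ps \<subseteq> S"
  shows "dfn M S (\<lambda>e. sat M (nth (map e is @ ps)) \<phi>)"
proof (rule dfnI)
  let ?r = "\<lambda>i. if i < length is then length ps + is ! i else i - length is"
  show "wf_fm M (ren_fm ?r \<phi>)" using assms by (simp add: wf_ren)
  show "set ps \<subseteq> S" by fact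
  show "sat M (prepend ps e) (ren_fm ?r \<phi>) = sat M (nth (map e is @ ps)) \<phi>" for e
    unfolding sat_ren by (rule sat_cong) (use assms(2) in \<open>auto simp: prepend_def nth_append\<close>)
qed

lemma dfn_mem:
  assumes "defined_by M \<phi> ps n D" "set ps \<subseteq> S" "length is = n"
  shows "dfn M S (\<lambda>e. map e is \<in> D)"
  using dfn_sat[of M \<phi> "is" ps S] assms by (simp add: defined_by_def)

text \<open>Initial variables turn into parameters. This specialises a uniform definition to fixed values of
  its parameters.\<close>

lemma dfn_subst:
  assumes "dfn M S P"
  shows "dfn M UNIV (\<lambda>e. P (prepend ds e))"
proof -
  obtain \<phi> cs where 1: "wf_fm M \<phi>" "set cs \<subseteq> S" "\<And>e. sat M (prepend cs e) \<phi> \<longleftrightarrow> P e"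
    using assms unfolding dfn_def by blast
  show ?thesis by (rule dfnI[of M \<phi> "cs @ ds"]) (use 1 in \<open>simp_all add: prepend_append\<close>)
qed

text \<open>From the semantic notion back to formulas. Variables beyond the first \<open>N\<close> may occur in the formula,
  but their values do not affect its truth. They are all merged into one variable, which is then
  bound by a quantifier; this also works for \<open>N = 0\<close> and \<open>es = []\<close>, where no free variable is
  available.\<close>

lemma dfn_imp_formula:
  fixes M :: "('f, 'r, 'a) fo_structure"
  assumes "dfn M (set es) P"
    and "\<And>e e'. (\<And>i. i < N \<Longrightarrow> e i = e' i) \<Longrightarrow> P e \<longleftrightarrow> P e'"
  obtains \<phi> where "wf_fm M \<phi>" "fv \<phi> \<subseteq> {..<N + length es}"
    "\<And>zs e. length zs = N \<Longrightarrow> sat M (nth (zs @ es)) \<phi> \<longleftrightarrow> P (prepend zs e)"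
proof -
  obtain \<psi>' cs where 1: "wf_fm M \<psi>'" "set cs \<subseteq> set es" "\<And>e. sat M (prepend cs e) \<psi>' \<longleftrightarrow> P e"
    using assms(1) unfolding dfn_def by blast
  obtain \<psi> where \<psi>: "wf_fm M \<psi>" "\<And>e. sat M (prepend es e) \<psi> \<longleftrightarrow> P e"
    by (rule sat_reparam[of cs es M \<psi>']) (use 1 in auto)
  \<comment> \<open>In the formula for \<open>P\<close> the parameters come first, in the result they come last. The value 0 is the
      variable that the added quantifier binds.\<close>
  let ?r = "\<lambda>i. if i < length es then Suc (N + i)
                else if i - length es < N then Suc (i - length es) else 0"
  let ?\<phi> = "Ex (ren_fm ?r \<psi>)"
  show thesis
  proof
    show "wf_fm M ?\<phi>" using \<psi> by (simp add: wf_ren)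
    show "fv ?\<phi> \<subseteq> {..<N + length es}"
      by (auto simp: fv_ren split: if_splits)
    fix zs :: "'a list" and e
    assume zs: "length zs = N"
    \<comment> \<open>The value \<open>a\<close> of the bound variable stands in for all variables beyond the first \<open>N\<close>.\<close>
    have "case_nat a (nth (zs @ es)) \<circ> ?r = prepend es (prepend zs (\<lambda>_. a))" for a
      using zs by (auto simp: prepend_def nth_append fun_eq_iff)
    then have "sat M (nth (zs @ es)) ?\<phi> \<longleftrightarrow> (\<exists>a. P (prepend zs (\<lambda>_. a)))"
      by (simp add: sat_ren \<psi>)
    also have "\<dots> \<longleftrightarrow> P (prepend zs e)"
    proof -
      have "P (prepend zs (\<lambda>_. a)) \<longleftrightarrow> P (prepend zs e)" for a
        by (rule assms(2)) (simp add: prepend_def zs)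
      then show ?thesis by simp
    qed
    finally show "sat M (nth (zs @ es)) ?\<phi> \<longleftrightarrow> P (prepend zs e)" .
  qed
qed

lemma block_cong: "(\<And>v. v < i + j \<Longrightarrow> e v = e' v) \<Longrightarrow> block i j e = block i j e'"
  unfolding block_def by (rule map_cong) auto

lemma definable_of_dfn:
  assumes "dfn M S (\<lambda>e. P (block 0 n e))"
  shows "definable M n {xs. length xs = n \<and> P xs}"
proof -
  obtain \<psi> cs where 1: "wf_fm M \<psi>" "\<And>e. sat M (prepend cs e) \<psi> \<longleftrightarrow> P (block 0 n e)"
    using assms unfolding dfn_def by blast
  have 2: "dfn M (set cs) (\<lambda>e. P (block 0 n e))"
    by (rule dfnI[OF 1(1) order_refl]) (simp add: 1(2))
  have 3: "P (block 0 n e) \<longleftrightarrow> P (block 0 n e')" if "\<And>i. i < n \<Longrightarrow> e i = e' i" for e e'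
  proof -
    have "block 0 n e = block 0 n e'" by (rule block_cong) (simp add: that)
    then show ?thesis by simp
  qed
  obtain \<phi> where "wf_fm M \<phi>" "fv \<phi> \<subseteq> {..<n + length cs}"
    "\<And>zs e. length zs = n \<Longrightarrow> sat M (nth (zs @ cs)) \<phi> \<longleftrightarrow> P (block 0 n (prepend zs e))"
    using dfn_imp_formula[of M cs "\<lambda>e. P (block 0 n e)" n, OF 2 3] by blast
  then have "defined_by M \<phi> cs n {xs. length xs = n \<and> P xs}"
    by (auto simp: defined_by_def block_prepend_0)
  then show ?thesis unfolding definable_def by blast
qed

lemma definable_length:
  assumes "definable M n D" "x \<in> D"
  shows "length x = n"
proof -
  obtain \<phi> ps where "D = {xs. length xs = n \<and> sat M (nth (xs @ ps)) \<phi>}"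
    using assms(1) unfolding definable_def defined_by_def by blast
  then show ?thesis using assms(2) by simp
qed

lemma dfn_mem_of_definable:
  assumes "definable M n D" "length is = n"
  shows "dfn M UNIV (\<lambda>e. map e is \<in> D)"
proof -
  obtain \<phi> ps where "defined_by M \<phi> ps n D" using assms(1) unfolding definable_def by blast
  then show ?thesis using assms(2) by (intro dfn_mem) simp_all
qed

lemma dfn_of_definable: "definable M n D \<Longrightarrow> dfn M UNIV (\<lambda>e. block i n e \<in> D)"
  unfolding block_def by (rule dfn_mem_of_definable) simp_all

lemma dfn_of_definable2:
  assumes "definable M (n + m) D"
  shows "dfn M UNIV (\<lambda>e. block i n e @ block j m e \<in> D)"
  using dfn_mem_of_definable[OF assms, of "[i..<i + n] @ [j..<j + m]"] by (simp add: block_def)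

lemmas dfn_intros = dfn_neg dfn_conj dfn_disj dfn_imp dfn_iff dfn_block_eq

section \<open>Induction in a definable finite power set\<close>

locale fin_pow =
  fixes M :: "('f, 'r, 'a) fo_structure" and n k :: nat and X Z :: "'a list set"
    and E :: "'a list \<Rightarrow> 'a list \<Rightarrow> bool"
  assumes fps: "finite_power_set M n X k Z E"
begin

text \<open>Outside \<open>X \<times> Z\<close> the relation \<open>E\<close> is arbitrary; \<open>mem\<close> restricts it to \<open>X \<times> Z\<close> and is thereby
  definable.\<close>

definition mem :: "'a list \<Rightarrow> 'a list \<Rightarrow> bool" where
  "mem x A \<longleftrightarrow> x @ A \<in> rel_graph X Z E"

definition elts :: "'a list \<Rightarrow> 'a list set" where
  "elts A = {x \<in> X. mem x A}"

abbreviation nil :: "'a list" where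
  "nil \<equiv> empty_code X Z E"

definition ins :: "'a list \<Rightarrow> 'a list \<Rightarrow> 'a list" where
  "ins x A = union_code X Z E A (single_code X Z E x)"

lemma definable_X: "definable M n X" and definable_Z: "definable M k Z"
  and definable_E: "definable M (n + k) (rel_graph X Z E)"
  using fps by (auto simp: finite_power_set_def)

lemma length_X: "x \<in> X \<Longrightarrow> length x = n" and length_Z: "A \<in> Z \<Longrightarrow> length A = k"
  using definable_length definable_X definable_Z by blast+

lemma mem_iff: "x \<in> X \<Longrightarrow> A \<in> Z \<Longrightarrow> mem x A \<longleftrightarrow> E x A"
  unfolding mem_def rel_graph_def using length_X by (auto simp: append_eq_append_conv)

lemma elts_iff: "A \<in> Z \<Longrightarrow> x \<in> elts A \<longleftrightarrow> x \<in> X \<and> E x A"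
  by (auto simp: elts_def mem_iff)

lemma elts_subset: "elts A \<subseteq> X"
  by (auto simp: elts_def)

lemma elts_inj: "A \<in> Z \<Longrightarrow> B \<in> Z \<Longrightarrow> elts A = elts B \<longleftrightarrow> A = B"
  using fps unfolding finite_power_set_def by (metis elts_iff)

lemma elts_eqI: "A \<in> Z \<Longrightarrow> B \<in> Z \<Longrightarrow> elts A = elts B \<Longrightarrow> A = B"
  using elts_inj by blast

lemma nil: "nil \<in> Z" "elts nil = {}"
proof -
  obtain B where B: "is_empty_code X Z E B"
    using fps by (auto simp: finite_power_set_def)
  have "is_empty_code X Z E nil"
    unfolding empty_code_def
  proof (rule theI[where a = B])
    show "is_empty_code X Z E B" by fact
    show "C = B" if "is_empty_code X Z E C" for C
      by (rule elts_eqI) (use that B in \<open>auto simp: is_empty_code_def elts_iff\<close>)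
  qed
  then show "nil \<in> Z" "elts nil = {}" by (auto simp: is_empty_code_def elts_iff)
qed

lemma ins:
  assumes "x \<in> X" "A \<in> Z"
  shows "ins x A \<in> Z" "elts (ins x A) = insert x (elts A)"
proof -
  obtain B where B: "is_single_code X Z E x B"
    using fps assms by (auto simp: finite_power_set_def)
  have 1: "is_single_code X Z E x (single_code X Z E x)"
    unfolding single_code_def
  proof (rule theI[where a = B])
    show "is_single_code X Z E x B" by fact
    show "C = B" if "is_single_code X Z E x C" for C
      by (rule elts_eqI) (use that B in \<open>auto simp: is_single_code_def elts_iff\<close>)
  qed
  then obtain D where D: "is_union_code X Z E A (single_code X Z E x) D"
    using fps assms unfolding finite_power_set_def is_single_code_def by meson
  have "is_union_code X Z E A (single_code X Z E x) (ins x A)"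
    unfolding ins_def union_code_def
  proof (rule theI[where a = D])
    show "is_union_code X Z E A (single_code X Z E x) D" by fact
    show "C = D" if "is_union_code X Z E A (single_code X Z E x) C" for C
      by (rule elts_eqI) (use that D in \<open>auto simp: is_union_code_def elts_iff\<close>)
  qed
  then show "ins x A \<in> Z" "elts (ins x A) = insert x (elts A)"
    using 1 assms by (auto simp: is_union_code_def is_single_code_def elts_iff)
qed

lemma ins_absorb:
  assumes "A \<in> Z" "x \<in> elts A"
  shows "ins x A = A"
proof -
  have "x \<in> X" using assms(2) elts_subset by blast
  then show ?thesis using ins[of x A] assms by (intro elts_eqI) auto
qed

text \<open>The induction axiom as a rule. The step may assume \<open>x \<notin>\<^sup>* A\<close>, as otherwise \<open>A \<union>\<^sup>* {x}\<^sup>* = A\<close>.\<close>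

lemma induct:
  assumes A: "A \<in> Z"
    and U: "dfn M UNIV (\<lambda>e. U (block 0 k e))"
    and base: "U nil"
    and step: "\<And>A x. A \<in> Z \<Longrightarrow> x \<in> X \<Longrightarrow> x \<notin> elts A \<Longrightarrow> U A \<Longrightarrow> U (ins x A)"
  shows "U A"
proof -
  let ?U = "{A. length A = k \<and> A \<in> Z \<and> U A}"
  have "definable M k ?U"
    by (intro definable_of_dfn[where S = UNIV] dfn_conj U dfn_of_definable definable_Z)
  moreover have "ins x A \<in> ?U" if "A \<in> ?U" "x \<in> X" for A x
    using that ins_absorb[of A x] step[of A x] ins[of x A] length_Z
    by (cases "x \<in> elts A") auto
  moreover have "nil \<in> ?U" using nil base length_Z by auto
  moreover have "?U \<subseteq> Z" by blast
  ultimately have "?U = Z"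
    using fps unfolding finite_power_set_def ins_def by blast
  then show ?thesis using A by auto
qed

lemmas dfn_Z = dfn_of_definable[OF definable_Z] and dfn_X = dfn_of_definable[OF definable_X]

lemma dfn_mem_code: "dfn M UNIV (\<lambda>e. mem (block i n e) (block j k e))"
  unfolding mem_def by (rule dfn_of_definable2[OF definable_E])

lemmas dfn_quant = dfn_bex[OF length_X dfn_X] dfn_ball[OF length_X dfn_X]
  dfn_bex[OF length_Z dfn_Z] dfn_ball[OF length_Z dfn_Z]

lemma subset_iff: "elts A \<subseteq> elts B \<longleftrightarrow> (\<forall>x\<in>X. mem x A \<longrightarrow> mem x B)"
  "elts A \<subseteq> elts B \<union> elts C \<longleftrightarrow> (\<forall>x\<in>X. mem x A \<longrightarrow> mem x B \<or> mem x C)"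
  by (auto simp: elts_def)

text \<open>Adding one element at a time does not reach all proper subsets of a set before the set itself, so
  the property that is proved by induction on \<open>A\<close> has to be stronger. It is: for every \<open>C\<close>, if all
  subsets of \<open>A \<union> C\<close> that do not include \<open>C\<close> satisfy \<open>U\<close>, then all subsets of \<open>A \<union> C\<close> do. For
  \<open>A = \<emptyset>\<close> the only subset of \<open>C\<close> that remains is \<open>C\<close>, which is the strong induction step. For
  \<open>A \<union> {x}\<close>, the hypothesis for \<open>A\<close> is used with \<open>C\<close>, which settles the sets without \<open>x\<close>, and then
  with \<open>C \<union> {x}\<close>. The goal is the case \<open>C = \<emptyset>\<close>, as every set includes \<open>\<emptyset>\<close>.\<close>

lemma strong_induct:
  assumes A: "A \<in> Z"
    and U: "\<And>i. dfn M UNIV (\<lambda>e. U (block i k e))"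
    and step: "\<And>A. A \<in> Z \<Longrightarrow> (\<And>B. B \<in> Z \<Longrightarrow> elts B \<subset> elts A \<Longrightarrow> U B) \<Longrightarrow> U A"
  shows "U A"
proof -
  define V where "V A \<longleftrightarrow> (\<forall>C\<in>Z.
      (\<forall>B\<in>Z. elts B \<subseteq> elts A \<union> elts C \<longrightarrow> \<not> elts C \<subseteq> elts B \<longrightarrow> U B) \<longrightarrow>
      (\<forall>B\<in>Z. elts B \<subseteq> elts A \<union> elts C \<longrightarrow> U B))" for A
  have "V A"
  proof (rule induct[OF A])
    show "dfn M UNIV (\<lambda>e. V (block 0 k e))"
      unfolding V_def subset_iff
      by (rule dfn_quant dfn_intros dfn_mem_code U | simp only: block_shift add.assoc)+
    show "V nil"
      unfolding V_def nil(2) by simp (metis psubset_eq step)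
    fix A x
    assume A: "A \<in> Z" "x \<in> X" and IH: "V A"
    show "V (ins x A)"
      unfolding V_def
    proof (intro ballI impI)
      fix C B
      assume C: "C \<in> Z" and B: "B \<in> Z" "elts B \<subseteq> elts (ins x A) \<union> elts C"
        and hyp: "\<forall>B\<in>Z. elts B \<subseteq> elts (ins x A) \<union> elts C \<longrightarrow> \<not> elts C \<subseteq> elts B \<longrightarrow> U B"
      \<comment> \<open>The hypothesis for \<open>A\<close> with \<open>C\<close>, and then, below, with \<open>C \<union> {x}\<close>.\<close>
      have 1: "U D" if "D \<in> Z" "elts D \<subseteq> elts A \<union> elts C" for D
        using IH C hyp that ins[OF A(2,1)] unfolding V_def by (metis Un_insert_left subset_insertI2)
      have "U D" if "D \<in> Z" "elts D \<subseteq> elts A \<union> elts (ins x C)" "\<not> elts (ins x C) \<subseteq> elts D" for D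
      proof (cases "x \<in> elts D")
        case True
        then show ?thesis using hyp that ins[OF A(2)] A C by auto
      next
        case False
        then show ?thesis using 1 that ins[OF A(2)] C by auto
      qed
      moreover have "elts B \<subseteq> elts A \<union> elts (ins x C)"
        using B(2) unfolding ins(2)[OF A(2,1)] ins(2)[OF A(2) C] by blast
      ultimately show "U B"
        using IH B(1) ins(1)[OF A(2) C] unfolding V_def by blast
    qed
  qed
  moreover have "elts nil \<subseteq> elts B" for B
    unfolding nil(2) by simp
  ultimately have "\<forall>B\<in>Z. elts B \<subseteq> elts A \<union> elts nil \<longrightarrow> U B"
    using nil(1) unfolding V_def by blast
  then show ?thesis using A by blast
qed

text \<open>The axioms provide unions only; differences with singletons come from induction.\<close>

lemma removal:
  assumes "A \<in> Z" "x \<in> X"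
  obtains C where "C \<in> Z" "elts C = elts A - {x}"
proof -
  have "\<forall>x\<in>X. \<exists>C\<in>Z. \<forall>t\<in>X. mem t C \<longleftrightarrow> mem t A \<and> \<not> t = x"
  proof (rule induct[OF assms(1)])
    show "dfn M UNIV (\<lambda>e. \<forall>x\<in>X. \<exists>C\<in>Z. \<forall>t\<in>X. mem t C \<longleftrightarrow> mem t (block 0 k e) \<and> \<not> t = x)"
      by (rule dfn_quant dfn_intros dfn_mem_code | simp only: block_shift add.assoc)+
    show "\<forall>x\<in>X. \<exists>C\<in>Z. \<forall>t\<in>X. mem t C \<longleftrightarrow> mem t nil \<and> \<not> t = x"
      using nil by (auto simp: elts_def)
    fix A a
    assume A: "A \<in> Z" "a \<in> X" "a \<notin> elts A"
      and IH: "\<forall>x\<in>X. \<exists>C\<in>Z. \<forall>t\<in>X. mem t C \<longleftrightarrow> mem t A \<and> \<not> t = x"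
    have mem_ins: "mem t (ins a B) \<longleftrightarrow> t = a \<or> mem t B" if "t \<in> X" "B \<in> Z" for t B
      using ins[OF A(2) that(2)] that A(2) by (auto simp: elts_def)
    show "\<forall>x\<in>X. \<exists>C\<in>Z. \<forall>t\<in>X. mem t C \<longleftrightarrow> mem t (ins a A) \<and> \<not> t = x"
    proof
      fix x
      assume "x \<in> X"
      with IH obtain C where C: "C \<in> Z" "\<forall>t\<in>X. mem t C \<longleftrightarrow> mem t A \<and> t \<noteq> x" by blast
      show "\<exists>C\<in>Z. \<forall>t\<in>X. mem t C \<longleftrightarrow> mem t (ins a A) \<and> \<not> t = x"
      proof (cases "x = a")
        case True
        then show ?thesis using C mem_ins A(1) by (intro bexI[of _ C]) auto
      next
        case False
        then show ?thesis using C mem_ins A ins by (intro bexI[of _ "ins a C"]) auto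
      qed
    qed
  qed
  then obtain C where "C \<in> Z" "\<forall>t\<in>X. mem t C \<longleftrightarrow> mem t A \<and> t \<noteq> x" using assms(2) by blast
  then show thesis using that by (auto simp: elts_def)
qed

section \<open>Uniqueness of recursively derived values\<close>

text \<open>The relation \<open>R\<close> is closed under the recursion equation and each of its pairs arises by it.
  Existence of a value needs only the closure. For uniqueness let \<open>A = B \<union>\<^sup>* {x}\<^sup>* = B' \<union>\<^sup>* {x'}\<^sup>*\<close> be
  two ways in which a value of \<open>A\<close> arises. If \<open>x = x'\<close> then \<open>B = B'\<close>. Otherwise both values are
  computed from a value of \<open>A\<close> without \<open>x\<close> and \<open>x'\<close>, in two different orders.\<close>

lemma recursion_functional:
  assumes Y: "definable M m Y" and R: "\<And>i j. dfn M UNIV (\<lambda>e. R (block i k e) (block j m e))"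
    and y0: "y0 \<in> Y" and g: "g \<in> X \<rightarrow> Y" and h: "h \<in> Y \<rightarrow> Y \<rightarrow> Y" "comm_assoc_on Y h"
    and R_nil: "R nil y0"
    and R_ins: "\<And>A x y. A \<in> Z \<Longrightarrow> x \<in> X \<Longrightarrow> x \<notin> elts A \<Longrightarrow> y \<in> Y \<Longrightarrow> R A y \<Longrightarrow>
                  R (ins x A) (h y (g x))"
    and R_cases: "\<And>A y. A \<in> Z \<Longrightarrow> y \<in> Y \<Longrightarrow> R A y \<Longrightarrow> A = nil \<and> y = y0 \<or>
                  (\<exists>B\<in>Z. \<exists>u\<in>Y. \<exists>x\<in>X. R B u \<and> x \<notin> elts B \<and> A = ins x B \<and> y = h u (g x))"
    and A: "A \<in> Z"
  shows "\<exists>!y. y \<in> Y \<and> R A y"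
proof -
  note dfn_Y = dfn_bex[OF definable_length[OF Y] dfn_of_definable[OF Y]]
    dfn_ball[OF definable_length[OF Y] dfn_of_definable[OF Y]]
  have comm: "\<forall>u\<in>Y. \<forall>v\<in>Y. h u v = h v u"
    and assoc: "\<forall>u\<in>Y. \<forall>v\<in>Y. \<forall>w\<in>Y. h (h u v) w = h u (h v w)"
    using h(2) unfolding comm_assoc_on_def by (rule conjunct1, rule conjunct2)
  have ex: "\<exists>y\<in>Y. R A y" if "A \<in> Z" for A
    using that
  proof (rule induct)
    show "dfn M UNIV (\<lambda>e. \<exists>y\<in>Y. R (block 0 k e) y)"
      by (rule dfn_Y dfn_intros R | simp only: block_shift add.assoc)+
    show "\<exists>y\<in>Y. R nil y" using R_nil y0 by blast
    show "\<exists>y\<in>Y. R (ins x A) y"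
      if "A \<in> Z" "x \<in> X" "x \<notin> elts A" "\<exists>y\<in>Y. R A y" for A x
      using that R_ins g h(1) by (metis Pi_mem)
  qed
  have "\<forall>y\<in>Y. \<forall>y'\<in>Y. R A y \<longrightarrow> R A y' \<longrightarrow> y = y'"
  proof (rule strong_induct[OF A])
    show "dfn M UNIV (\<lambda>e. \<forall>y\<in>Y. \<forall>y'\<in>Y. R (block i k e) y \<longrightarrow> R (block i k e) y' \<longrightarrow> y = y')" for i
      by (rule dfn_Y dfn_intros R | simp only: block_shift add.assoc)+
    fix A
    assume A: "A \<in> Z"
      and IH: "\<And>B. B \<in> Z \<Longrightarrow> elts B \<subset> elts A \<Longrightarrow> \<forall>y\<in>Y. \<forall>y'\<in>Y. R B y \<longrightarrow> R B y' \<longrightarrow> y = y'"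
    show "\<forall>y\<in>Y. \<forall>y'\<in>Y. R A y \<longrightarrow> R A y' \<longrightarrow> y = y'"
    proof (intro ballI impI)
      fix y y'
      assume y: "y \<in> Y" "R A y" and y': "y' \<in> Y" "R A y'"
      show "y = y'"
      proof (cases "elts A = {}")
        case True
        then have "\<not> (\<exists>B\<in>Z. \<exists>x\<in>X. A = ins x B)" using ins by blast
        then show ?thesis using R_cases[OF A y] R_cases[OF A y'] by blast
      next
        case False
        then have "A \<noteq> nil" using nil by auto
        then obtain B u x B' u' x' where
          B: "B \<in> Z" "u \<in> Y" "x \<in> X" "R B u" "x \<notin> elts B" "A = ins x B" "y = h u (g x)" and
          B': "B' \<in> Z" "u' \<in> Y" "x' \<in> X" "R B' u'" "x' \<notin> elts B'" "A = ins x' B'" "y' = h u' (g x')"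
          using R_cases[OF A y] R_cases[OF A y'] by metis
        have extA: "elts A = insert x (elts B)" "elts A = insert x' (elts B')"
          using ins(2)[OF B(3,1), folded B(6)] ins(2)[OF B'(3,1), folded B'(6)] .
        have in_A: "x \<in> elts A" "x' \<in> elts A"
          by (subst extA(1), rule insertI1, subst extA(2), rule insertI1)
        have elts_B: "elts B = elts A - {x}"
          unfolding extA(1) by (rule Diff_insert_absorb[OF B(5), symmetric])
        have elts_B': "elts B' = elts A - {x'}"
          unfolding extA(2) by (rule Diff_insert_absorb[OF B'(5), symmetric])
        have sub: "elts B \<subset> elts A" "elts B' \<subset> elts A"
          unfolding elts_B elts_B' using in_A by blast+
        show ?thesis
        proof (cases "x = x'")
          case True
          then have "elts B = elts B'" unfolding elts_B elts_B' by simp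
          then have "B = B'" by (rule elts_eqI[OF B(1) B'(1)])
          then have "u = u'" using IH[OF B(1) sub(1), rule_format, OF B(2) B'(2) B(4)] B'(4) by simp
          then show ?thesis using True B(7) B'(7) by simp
        next
          case False
          \<comment> \<open>This is \<open>A\<close> without \<open>x\<close> and \<open>x'\<close>, so adding \<open>x'\<close> gives \<open>B\<close> and adding \<open>x\<close> gives \<open>B'\<close>.\<close>
          obtain C where C: "C \<in> Z" "elts C = elts B - {x'}" using removal[OF B(1) B'(3)] .
          have x_C: "x' \<notin> elts C" "x \<notin> elts C" using C(2) B(5) by simp_all
          have "elts B = insert x' (elts C)" "elts B' = insert x (elts C)"
            unfolding C(2) elts_B elts_B' using in_A False by blast+
          then have BC: "B = ins x' C" "B' = ins x C"
            using elts_eqI[OF B(1) ins(1)[OF B'(3) C(1)]] elts_eqI[OF B'(1) ins(1)[OF B(3) C(1)]]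
              ins(2)[OF B'(3) C(1)] ins(2)[OF B(3) C(1)] by simp_all
          obtain v where v: "v \<in> Y" "R C v" using ex C(1) by blast
          have gY: "g x \<in> Y" "g x' \<in> Y" using g B(3) B'(3) by auto
          then have hY: "h v (g x) \<in> Y" "h v (g x') \<in> Y" using h(1) v(1) by auto
          have "R B (h v (g x'))" "R B' (h v (g x))"
            unfolding BC by (rule R_ins[OF C(1) B'(3) x_C(1) v] R_ins[OF C(1) B(3) x_C(2) v])+
          then have "u = h v (g x')" "u' = h v (g x)"
            using IH[OF B(1) sub(1), rule_format, OF B(2) hY(2) B(4)]
              IH[OF B'(1) sub(2), rule_format, OF B'(2) hY(1) B'(4)] by simp_all
          moreover have "h (h v (g x')) (g x) = h (h v (g x)) (g x')"
            using assoc[rule_format, OF v(1) gY(2,1)] assoc[rule_format, OF v(1) gY]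
              comm[rule_format, OF gY] by simp
          ultimately show ?thesis using B(7) B'(7) by simp
        qed
      qed
    qed
  qed
  then show ?thesis using ex[OF A] by blast
qed

text \<open>Two solutions agree by plain induction. Their agreement at \<open>A\<close> is expressed through the graphs,
  because it is the graphs that are definable.\<close>

lemma recursive_solution_unique:
  assumes Y: "definable M m Y"
    and G: "recursive_solution M X k Z E m Y y0 g h G"
    and G': "recursive_solution M X k Z E m Y y0 g h G'"
  shows "G = G'"
proof -
  note dfn_Y = dfn_bex[OF definable_length[OF Y] dfn_of_definable[OF Y]]
  have graph: "A @ y \<in> fun_graph Z F \<longleftrightarrow> y = F A" if "A \<in> Z" for A y F
    using that by (auto simp: fun_graph_def length_Z)
  have defs: "definable M (k + m) (fun_graph Z G)" "definable M (k + m) (fun_graph Z G')"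
    and maps: "G \<in> Z \<rightarrow>\<^sub>E Y" "G' \<in> Z \<rightarrow>\<^sub>E Y"
    using G G' by (auto simp: recursive_solution_def)
  have "\<exists>y\<in>Y. A @ y \<in> fun_graph Z G \<and> A @ y \<in> fun_graph Z G'" if "A \<in> Z" for A
    using that
  proof (rule induct)
    show "dfn M UNIV (\<lambda>e. \<exists>y\<in>Y. block 0 k e @ y \<in> fun_graph Z G \<and> block 0 k e @ y \<in> fun_graph Z G')"
      by (rule dfn_Y dfn_intros dfn_of_definable2 defs | simp only: block_shift add.assoc)+
    show "\<exists>y\<in>Y. nil @ y \<in> fun_graph Z G \<and> nil @ y \<in> fun_graph Z G'"
      using G G' maps nil(1) by (auto simp: graph recursive_solution_def)
    fix A x
    assume A: "A \<in> Z" "x \<in> X" "x \<notin> elts A"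
      and IH: "\<exists>y\<in>Y. A @ y \<in> fun_graph Z G \<and> A @ y \<in> fun_graph Z G'"
    have "G (ins x A) = h (G A) (g x)" "G' (ins x A) = h (G' A) (g x)"
      using G G' A by (auto simp: recursive_solution_def ins_def elts_iff)
    moreover have "G A = G' A" using IH unfolding graph[OF A(1)] by (elim bexE conjE) (rule trans[OF sym])
    moreover have "G (ins x A) \<in> Y" using maps(1) ins(1)[OF A(2,1)] by (rule PiE_mem)
    ultimately show "\<exists>y\<in>Y. ins x A @ y \<in> fun_graph Z G \<and> ins x A @ y \<in> fun_graph Z G'"
      using ins(1)[OF A(2,1)] by (simp add: graph)
  qed
  then have "G A = G' A" if "A \<in> Z" for A
    using that by (simp add: graph)
  then show ?thesis by (rule PiE_ext[OF maps])
qed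

end

section \<open>Derivations\<close>

lemma take_block: "take k (block i (k + m) e) = block i k e"
  and drop_block: "drop k (block i (k + m) e) = block (i + k) m e"
  by (rule nth_equalityI; simp add: add.assoc)+

text \<open>The set \<open>W\<close> codes finite sets of pairs, and \<open>L w A y\<close> says that \<open>(A, y)\<close> belongs to \<open>w\<close>. The
  relations \<open>gr ps\<close> and \<open>hr qs\<close> stand for the graphs of \<open>g\<close> and \<open>h\<close> defined with the parameters
  \<open>ps\<close> and \<open>qs\<close>. These parameters, of lengths \<open>p\<close> and \<open>q\<close>, are arguments rather than fixed because
  one formula has to serve all of them, whereas everything else is definable over the fixed set
  \<open>S\<close>.\<close>

locale derivations = fin_pow M n k X Z E
  for M :: "('f, 'r, 'a) fo_structure" and n k X Z E +
  fixes S :: "'a set" and m l p q :: nat and Y W :: "'a list set"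
    and L :: "'a list \<Rightarrow> 'a list \<Rightarrow> 'a list \<Rightarrow> bool"
    and gr :: "'a list \<Rightarrow> 'a list \<Rightarrow> 'a list \<Rightarrow> bool"
    and hr :: "'a list \<Rightarrow> 'a list \<Rightarrow> 'a list \<Rightarrow> 'a list \<Rightarrow> bool"
  assumes Y: "definable M m Y" and W: "definable M l W"
    and dfn_S: "\<And>i. dfn M S (\<lambda>e. block i n e \<in> X)" "\<And>i. dfn M S (\<lambda>e. block i k e \<in> Z)"
      "\<And>i. dfn M S (\<lambda>e. block i m e \<in> Y)" "\<And>i. dfn M S (\<lambda>e. block i l e \<in> W)"
      "\<And>i j. dfn M S (\<lambda>e. mem (block i n e) (block j k e))"
      "\<And>i j r. dfn M S (\<lambda>e. L (block i l e) (block j k e) (block r m e))"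
      "\<And>i j r. dfn M S (\<lambda>e. gr (block i p e) (block j n e) (block r m e))"
      "\<And>i j r s. dfn M S (\<lambda>e. hr (block i q e) (block j m e) (block r m e) (block s m e))"
    and L_empty: "\<exists>w\<in>W. \<forall>A\<in>Z. \<forall>y\<in>Y. \<not> L w A y"
    and L_insert: "\<And>w A y. w \<in> W \<Longrightarrow> A \<in> Z \<Longrightarrow> y \<in> Y \<Longrightarrow>
      \<exists>w'\<in>W. \<forall>B\<in>Z. \<forall>z\<in>Y. L w' B z \<longleftrightarrow> L w B z \<or> B = A \<and> z = y"
begin

definition justified ::
    "'a list \<Rightarrow> 'a list \<Rightarrow> 'a list \<Rightarrow> 'a list \<Rightarrow> 'a list \<Rightarrow> 'a list \<Rightarrow> bool" where
  "justified y0 ps qs w A y \<longleftrightarrow>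
     (\<forall>x\<in>X. \<not> mem x A) \<and> y = y0 \<or>
     (\<exists>B\<in>Z. \<exists>u\<in>Y. \<exists>x\<in>X. \<exists>v\<in>Y. L w B u \<and> \<not> mem x B \<and>
        (\<forall>t\<in>X. mem t A \<longleftrightarrow> mem t B \<or> t = x) \<and> gr ps x v \<and> hr qs u v y)"

definition derivation :: "'a list \<Rightarrow> 'a list \<Rightarrow> 'a list \<Rightarrow> 'a list \<Rightarrow> bool" where
  "derivation y0 ps qs w \<longleftrightarrow> (\<forall>A\<in>Z. \<forall>y\<in>Y. L w A y \<longrightarrow> justified y0 ps qs w A y)"

definition derivable :: "'a list \<Rightarrow> 'a list \<Rightarrow> 'a list \<Rightarrow> 'a list \<Rightarrow> 'a list \<Rightarrow> bool" where
  "derivable y0 ps qs A y \<longleftrightarrow> (\<exists>w\<in>W. derivation y0 ps qs w \<and> L w A y)"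

lemma dfn_derivable:
  "dfn M S (\<lambda>e. derivable (block a m e) (block b p e) (block c q e) (block i k e) (block j m e))"
proof -
  note quant = dfn_bex[OF length_X dfn_S(1)] dfn_ball[OF length_X dfn_S(1)]
    dfn_bex[OF length_Z dfn_S(2)] dfn_ball[OF length_Z dfn_S(2)]
    dfn_bex[OF definable_length[OF Y] dfn_S(3)] dfn_ball[OF definable_length[OF Y] dfn_S(3)]
    dfn_bex[OF definable_length[OF W] dfn_S(4)]
  show ?thesis
    unfolding derivable_def derivation_def justified_def
    by (rule quant dfn_intros dfn_S | simp only: block_shift add.assoc)+
qed

lemma dfn_derivable_const:
  assumes "length y0 = m" "length ps = p" "length qs = q"
  shows "dfn M UNIV (\<lambda>e. derivable y0 ps qs (block i k e) (block j m e))"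
proof -
  let ?N = "m + p + q"
  have "block 0 m (prepend (y0 @ ps @ qs) e) = y0" "block m p (prepend (y0 @ ps @ qs) e) = ps"
    "block (m + p) q (prepend (y0 @ ps @ qs) e) = qs"
    "block (?N + i) k (prepend (y0 @ ps @ qs) e) = block i k e"
    "block (?N + j) m (prepend (y0 @ ps @ qs) e) = block j m e" for e
    using assms by (simp_all add: prepend_append block_prepend_skip block_prepend_0)
  then show ?thesis
    using dfn_subst[OF dfn_derivable[of 0 m "m + p" "?N + i" "?N + j"], of "y0 @ ps @ qs"] by simp
qed

text \<open>A set of pairs as a set of tuples, in the form in which formulas define it.\<close>

lemma pairs_eq:
  "{A @ y | A y. A \<in> Z \<and> y \<in> Y \<and> R A y} =
   {xs. length xs = k + m \<and> take k xs \<in> Z \<and> drop k xs \<in> Y \<and> R (take k xs) (drop k xs)}"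
proof (intro equalityI subsetI)
  fix xs
  assume "xs \<in> {A @ y | A y. A \<in> Z \<and> y \<in> Y \<and> R A y}"
  then show "xs \<in> {xs. length xs = k + m \<and> take k xs \<in> Z \<and> drop k xs \<in> Y \<and>
      R (take k xs) (drop k xs)}"
    using length_Z definable_length[OF Y] by auto
next
  fix xs
  assume "xs \<in> {xs. length xs = k + m \<and> take k xs \<in> Z \<and> drop k xs \<in> Y \<and>
      R (take k xs) (drop k xs)}"
  moreover have "xs = take k xs @ drop k xs" by simp
  ultimately show "xs \<in> {A @ y | A y. A \<in> Z \<and> y \<in> Y \<and> R A y}" by blast
qed

text \<open>Derivable values satisfy the hypotheses of \<open>recursion_functional\<close>: a derivation remains one when a
  pair that it justifies is added, and each of its pairs is justified.\<close>

lemma solution: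
  assumes y0: "y0 \<in> Y" and g: "g \<in> X \<rightarrow> Y" and h: "h \<in> Y \<rightarrow> Y \<rightarrow> Y" "comm_assoc_on Y h"
    and len: "length ps = p" "length qs = q"
    and gr: "\<And>x v. x \<in> X \<Longrightarrow> v \<in> Y \<Longrightarrow> gr ps x v \<longleftrightarrow> v = g x"
    and hr: "\<And>u v y. u \<in> Y \<Longrightarrow> v \<in> Y \<Longrightarrow> y \<in> Y \<Longrightarrow> hr qs u v y \<longleftrightarrow> y = h u v"
  obtains G where "recursive_solution M X k Z E m Y y0 g h G"
    "fun_graph Z G = {A @ y | A y. A \<in> Z \<and> y \<in> Y \<and> derivable y0 ps qs A y}"
proof -
  let ?R = "derivable y0 ps qs"
  have justified_iff: "justified y0 ps qs w A y \<longleftrightarrow> A = nil \<and> y = y0 \<or>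
      (\<exists>B\<in>Z. \<exists>u\<in>Y. \<exists>x\<in>X. L w B u \<and> x \<notin> elts B \<and> A = ins x B \<and> y = h u (g x))"
    if A: "A \<in> Z" and y: "y \<in> Y" for w A y
  proof -
    have "(\<forall>x\<in>X. \<not> mem x A) \<longleftrightarrow> A = nil"
      using elts_inj[OF A nil(1)] nil(2) by (auto simp: elts_def)
    moreover have "(\<forall>t\<in>X. mem t A \<longleftrightarrow> mem t B \<or> t = x) \<longleftrightarrow> A = ins x B" if "B \<in> Z" "x \<in> X" for B x
      using elts_inj[OF A ins(1)[OF that(2,1)]] ins(2)[OF that(2,1)] that(2)
      by (auto simp: elts_def)
    moreover have "(\<exists>v\<in>Y. gr ps x v \<and> hr qs u v y) \<longleftrightarrow> y = h u (g x)" if "x \<in> X" "u \<in> Y" for x u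
      using gr[OF that(1)] hr[OF that(2) _ y] g that(1) by (metis Pi_mem)
    moreover have "mem x B \<longleftrightarrow> x \<in> elts B" if "x \<in> X" for x B
      using that by (simp add: elts_def)
    ultimately show ?thesis
      unfolding justified_def by (simp cong: bex_cong)
  qed
  have justified_mono: "justified y0 ps qs w' A y"
    if "justified y0 ps qs w A y" "\<And>B u. B \<in> Z \<Longrightarrow> u \<in> Y \<Longrightarrow> L w B u \<Longrightarrow> L w' B u" for w w' A y
    using that unfolding justified_def by blast
  have extend: "\<exists>w'\<in>W. derivation y0 ps qs w' \<and> L w' A y"
    if w: "w \<in> W" "derivation y0 ps qs w" and A: "A \<in> Z" and y: "y \<in> Y"
      and new: "justified y0 ps qs w A y" for w A y
  proof -
    obtain w' where w': "w' \<in> W" "\<forall>B\<in>Z. \<forall>z\<in>Y. L w' B z \<longleftrightarrow> L w B z \<or> B = A \<and> z = y"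
      using L_insert[OF w(1) A y] by blast
    have "justified y0 ps qs w' B z" if B: "B \<in> Z" "z \<in> Y" "L w' B z" for B z
    proof (rule justified_mono)
      show "justified y0 ps qs w B z"
        using w' B w(2) new unfolding derivation_def by blast
      show "L w' B u" if "B \<in> Z" "u \<in> Y" "L w B u" for B u
        using w'(2) that by blast
    qed
    then show ?thesis using w' A y unfolding derivation_def by blast
  qed
  have R_nil: "?R nil y0"
  proof -
    obtain w where "w \<in> W" "\<forall>A\<in>Z. \<forall>y\<in>Y. \<not> L w A y" using L_empty by blast
    then show ?thesis
      unfolding derivable_def using nil(1) y0
      by (intro extend[of w]) (auto simp: derivation_def justified_iff)
  qed
  have R_ins: "?R (ins x A) (h y (g x))"
    if prem: "A \<in> Z" "x \<in> X" "x \<notin> elts A" "y \<in> Y" "?R A y" for A x y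
  proof -
    obtain w where w: "w \<in> W" "derivation y0 ps qs w" "L w A y"
      using prem(5) unfolding derivable_def by blast
    have hY: "h y (g x) \<in> Y" using prem g h(1) by auto
    show ?thesis
      unfolding derivable_def using ins(1)[OF prem(2,1)] hY prem w
      by (intro extend[of w]) (auto simp: justified_iff)
  qed
  have R_cases: "A = nil \<and> y = y0 \<or>
      (\<exists>B\<in>Z. \<exists>u\<in>Y. \<exists>x\<in>X. ?R B u \<and> x \<notin> elts B \<and> A = ins x B \<and> y = h u (g x))"
    if prem: "A \<in> Z" "y \<in> Y" "?R A y" for A y
  proof -
    obtain w where w: "w \<in> W" "derivation y0 ps qs w" "L w A y"
      using prem(3) unfolding derivable_def by blast
    then have "justified y0 ps qs w A y" using prem unfolding derivation_def by blast
    then show ?thesis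
      unfolding justified_iff[OF prem(1,2)] using w(1,2) unfolding derivable_def by blast
  qed
  have dfn_R: "dfn M UNIV (\<lambda>e. ?R (block i k e) (block j m e))" for i j
    by (rule dfn_derivable_const) (use definable_length[OF Y y0] len in auto)
  have functional: "\<exists>!y. y \<in> Y \<and> ?R A y" if "A \<in> Z" for A
    by (rule recursion_functional[OF Y dfn_R y0 g h R_nil R_ins R_cases that])
  define G where "G = restrict (\<lambda>A. THE y. y \<in> Y \<and> ?R A y) Z"
  have G: "G A \<in> Y" "?R A (G A)" if "A \<in> Z" for A
    using theI'[OF functional[OF that]] that by (auto simp: G_def)
  have G_eq: "G A = y" if "A \<in> Z" "y \<in> Y" "?R A y" for A y
    using functional[OF that(1)] G[OF that(1)] that by blast
  have graph: "fun_graph Z G = {A @ y | A y. A \<in> Z \<and> y \<in> Y \<and> ?R A y}"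
    unfolding fun_graph_def using G G_eq by blast
  let ?P = "\<lambda>xs. take k xs \<in> Z \<and> drop k xs \<in> Y \<and> ?R (take k xs) (drop k xs)"
  have "dfn M UNIV (\<lambda>e. ?P (block 0 (k + m) e))"
    unfolding take_block drop_block
    by (intro dfn_conj dfn_R dfn_of_definable definable_Z Y)
  then have "definable M (k + m) {xs. length xs = k + m \<and> ?P xs}"
    by (rule definable_of_dfn)
  moreover have "{xs. length xs = k + m \<and> ?P xs} = fun_graph Z G"
    unfolding graph pairs_eq ..
  ultimately have "definable M (k + m) (fun_graph Z G)" by simp
  moreover have "G \<in> Z \<rightarrow>\<^sub>E Y" using G by (auto simp: G_def)
  moreover have "G nil = y0" by (rule G_eq[OF nil(1) y0 R_nil])
  moreover have "G (ins x A) = h (G A) (g x)" if "A \<in> Z" "x \<in> X" "\<not> E x A" for A x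
    using that G[OF that(1)] g h(1)
    by (intro G_eq ins(1) R_ins) (auto simp: elts_iff)
  ultimately have "recursive_solution M X k Z E m Y y0 g h G"
    by (simp add: recursive_solution_def ins_def)
  then show thesis using graph by (rule that)
qed

lemma uniform_formula:
  assumes "S \<subseteq> set es"
  obtains \<Gamma> where "wf_fm M \<Gamma>" "fv \<Gamma> \<subseteq> {..<k + m + m + p + q + length es}"
    "\<And>y0 ps qs. y0 \<in> Y \<Longrightarrow> length ps = p \<Longrightarrow> length qs = q \<Longrightarrow>
      defined_by M \<Gamma> (y0 @ ps @ qs @ es) (k + m)
        {A @ y | A y. A \<in> Z \<and> y \<in> Y \<and> derivable y0 ps qs A y}"
proof -
  let ?P = "\<lambda>e. block 0 k e \<in> Z \<and> block k m e \<in> Y \<and>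
    derivable (block (k + m) m e) (block (k + m + m) p e) (block (k + m + m + p) q e)
      (block 0 k e) (block k m e)"
  let ?N = "k + m + m + p + q"
  have "dfn M S ?P"
    by (intro dfn_conj dfn_S dfn_derivable)
  then have 1: "dfn M (set es) ?P" using assms by (rule dfn_mono)
  have 2: "?P e \<longleftrightarrow> ?P e'" if "\<And>i. i < ?N \<Longrightarrow> e i = e' i" for e e'
  proof -
    have "block i j e = block i j e'" if "i + j \<le> ?N" for i j
      by (rule block_cong, rule \<open>\<And>i. i < ?N \<Longrightarrow> e i = e' i\<close>) (use that in simp)
    then show ?thesis by simp
  qed
  obtain \<Gamma> where \<Gamma>: "wf_fm M \<Gamma>" "fv \<Gamma> \<subseteq> {..<?N + length es}"
    "\<And>zs e. length zs = ?N \<Longrightarrow> sat M (nth (zs @ es)) \<Gamma> \<longleftrightarrow> ?P (prepend zs e)"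
    using dfn_imp_formula[of M es ?P ?N, OF 1 2] by blast
  show thesis
  proof (rule that[OF \<Gamma>(1,2)])
    fix y0 ps qs :: "'a list"
    assume y0: "y0 \<in> Y" and len: "length ps = p" "length qs = q"
    have m: "length y0 = m" using definable_length[OF Y y0] .
    have "sat M (nth (xs @ y0 @ ps @ qs @ es)) \<Gamma> \<longleftrightarrow>
        take k xs \<in> Z \<and> drop k xs \<in> Y \<and> derivable y0 ps qs (take k xs) (drop k xs)"
      if xs: "length xs = k + m" for xs
    proof -
      let ?zs = "take k xs @ drop k xs @ y0 @ ps @ qs"
      have blocks: "block 0 k (prepend ?zs e) = take k xs" "block k m (prepend ?zs e) = drop k xs"
        "block (k + m) m (prepend ?zs e) = y0" "block (k + m + m) p (prepend ?zs e) = ps"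
        "block (k + m + m + p) q (prepend ?zs e) = qs" for e
        using xs m len by (simp_all only: prepend_append) (simp_all add: block_prepend_skip block_prepend_0)
      have len_zs: "length ?zs = ?N" using xs m len by simp
      have "?zs @ es = (take k xs @ drop k xs) @ y0 @ ps @ qs @ es"
        unfolding append_assoc ..
      then have zs_es: "?zs @ es = xs @ y0 @ ps @ qs @ es"
        unfolding append_take_drop_id .
      show ?thesis using \<Gamma>(3)[OF len_zs] unfolding blocks zs_es .
    qed
    then have "{A @ y | A y. A \<in> Z \<and> y \<in> Y \<and> derivable y0 ps qs A y} =
        {xs. length xs = k + m \<and> sat M (nth (xs @ y0 @ ps @ qs @ es)) \<Gamma>}"
      unfolding pairs_eq by (intro Collect_cong conj_cong refl) simp
    then show "defined_by M \<Gamma> (y0 @ ps @ qs @ es) (k + m)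
        {A @ y | A y. A \<in> Z \<and> y \<in> Y \<and> derivable y0 ps qs A y}"
      using \<Gamma>(1,2) m len by (simp add: defined_by_def add.assoc)
  qed
qed

end

section \<open>Recursion along a definable finite power set\<close>

theorem theorem5p7:
  fixes M :: "('f, 'r, 'a) fo_structure"
    and n m k :: nat
    and X Y FX :: "'a list set"
    and E :: "'a list \<Rightarrow> 'a list \<Rightarrow> bool"
  assumes "admits_finite_power_sets M"
    and "definable M n X"
    and "definable M m Y"
    and "finite_power_set M n X k FX E"
  shows
    "(\<forall>y0 g h.
        y0 \<in> Y \<and>
        g \<in> X \<rightarrow> Y \<and> definable M (n + m) (fun_graph X g) \<and>
        h \<in> Y \<rightarrow> Y \<rightarrow> Y \<and> definable M (m + m + m) (op_graph Y h) \<and> comm_assoc_on Y h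
        \<longrightarrow> (\<exists>!G. recursive_solution M X k FX E m Y y0 g h G))
     \<and>
     (\<exists>es :: 'a list. \<forall>(\<gamma> :: ('f, 'r) fm) (\<eta> :: ('f, 'r) fm) (p :: nat) (q :: nat).
        \<exists>\<Gamma> :: ('f, 'r) fm. \<forall>y0 g h ps qs G.
          length ps = p \<and> length qs = q \<and>
          y0 \<in> Y \<and>
          g \<in> X \<rightarrow> Y \<and> defined_by M \<gamma> ps (n + m) (fun_graph X g) \<and>
          h \<in> Y \<rightarrow> Y \<rightarrow> Y \<and> defined_by M \<eta> qs (m + m + m) (op_graph Y h) \<and> comm_assoc_on Y h \<and>
          recursive_solution M X k FX E m Y y0 g h G
          \<longrightarrow> defined_by M \<Gamma> (y0 @ ps @ qs @ es) (k + m) (fun_graph FX G))"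
proof -
  interpret F: fin_pow M n k X FX E by unfold_locales (fact assms(4))
  have len_Y: "length y = m" if "y \<in> Y" for y using definable_length[OF assms(3) that] .
  let ?P = "\<lambda>xs. take k xs \<in> FX \<and> drop k xs \<in> Y"
  \<comment> \<open>The domain \<open>\<F>(X) \<times> Y\<close> of the pairs that derivations consist of.\<close>
  define T where "T = {xs. length xs = k + m \<and> ?P xs}"
  have T_iff: "A @ y \<in> T \<longleftrightarrow> A \<in> FX \<and> y \<in> Y" if "length A = k" for A y
    using that len_Y by (auto simp: T_def)
  have "dfn M UNIV (\<lambda>e. ?P (block 0 (k + m) e))"
    unfolding take_block drop_block by (intro dfn_conj dfn_of_definable F.definable_Z assms(3))
  then have "definable M (k + m) T" unfolding T_def by (rule definable_of_dfn)
  then obtain l W EW where W: "finite_power_set M (k + m) T l W EW"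
    using assms(1) unfolding admits_finite_power_sets_def by blast
  interpret D: fin_pow M "k + m" l T W EW by unfold_locales (fact W)
  define L where "L w A y = D.mem (A @ y) w" for w A y
  obtain \<phi>1 c1 where c1: "defined_by M \<phi>1 c1 n X" using assms(2) definable_def by blast
  obtain \<phi>2 c2 where c2: "defined_by M \<phi>2 c2 m Y" using assms(3) definable_def by blast
  obtain \<phi>3 c3 where c3: "defined_by M \<phi>3 c3 k FX" using F.definable_Z definable_def by blast
  obtain \<phi>4 c4 where c4: "defined_by M \<phi>4 c4 l W" using D.definable_Z definable_def by blast
  obtain \<phi>5 c5 where c5: "defined_by M \<phi>5 c5 (n + k) (rel_graph X FX E)"
    using F.definable_E definable_def by blast
  obtain \<phi>6 c6 where c6: "defined_by M \<phi>6 c6 (k + m + l) (rel_graph T W EW)"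
    using D.definable_E definable_def by blast
  \<comment> \<open>The uniform parameters define \<open>X\<close>, \<open>Y\<close> and the two finite power sets.\<close>
  define es where "es = c1 @ c2 @ c3 @ c4 @ c5 @ c6"
  define gr where "gr \<gamma> ps x v = sat M (nth (x @ v @ ps)) \<gamma>" for \<gamma> ps x v
  define hr where "hr \<eta> qs u v y = sat M (nth (u @ v @ y @ qs)) \<eta>" for \<eta> qs u v y
  have deriv: "derivations M n k X FX E (set es) m l p q Y W L (gr \<gamma>) (hr \<eta>)"
    if \<gamma>: "wf_fm M \<gamma>" "fv \<gamma> \<subseteq> {..<n + m + p}" and \<eta>: "wf_fm M \<eta>" "fv \<eta> \<subseteq> {..<m + m + m + q}"
    for \<gamma> \<eta> p q
  proof
    show "definable M m Y" "definable M l W" using assms(3) D.definable_Z .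
    show "dfn M (set es) (\<lambda>e. block i n e \<in> X)" for i
      unfolding block_def by (rule dfn_mem[OF c1]) (auto simp: es_def)
    show "dfn M (set es) (\<lambda>e. block i m e \<in> Y)" for i
      unfolding block_def by (rule dfn_mem[OF c2]) (auto simp: es_def)
    show "dfn M (set es) (\<lambda>e. block i k e \<in> FX)" for i
      unfolding block_def by (rule dfn_mem[OF c3]) (auto simp: es_def)
    show "dfn M (set es) (\<lambda>e. block i l e \<in> W)" for i
      unfolding block_def by (rule dfn_mem[OF c4]) (auto simp: es_def)
    show "dfn M (set es) (\<lambda>e. F.mem (block i n e) (block j k e))" for i j
      unfolding F.mem_def block_def map_append[symmetric]
      by (rule dfn_mem[OF c5]) (auto simp: es_def)
    show "dfn M (set es) (\<lambda>e. L (block i l e) (block j k e) (block r m e))" for i j r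
      unfolding L_def D.mem_def block_def map_append[symmetric]
      by (rule dfn_mem[OF c6]) (auto simp: es_def)
    show "dfn M (set es) (\<lambda>e. gr \<gamma> (block i p e) (block j n e) (block r m e))" for i j r
      using dfn_sat[of M \<gamma> "[j..<j + n] @ [r..<r + m] @ [i..<i + p]" "[]" "set es"] \<gamma>
      by (simp add: gr_def block_def add.assoc)
    show "dfn M (set es) (\<lambda>e. hr \<eta> (block i q e) (block j m e) (block r m e) (block s m e))" for i j r s
      using dfn_sat[of M \<eta> "[j..<j + m] @ [r..<r + m] @ [s..<s + m] @ [i..<i + q]" "[]" "set es"] \<eta>
      by (simp add: hr_def block_def add.assoc)
    have L_iff: "L w A y \<longleftrightarrow> A @ y \<in> D.elts w" if "A \<in> FX" "y \<in> Y" for w A y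
      using that T_iff[OF F.length_Z] by (simp add: L_def D.elts_def)
    show "\<exists>w\<in>W. \<forall>A\<in>FX. \<forall>y\<in>Y. \<not> L w A y"
      using D.nil by (intro bexI[of _ D.nil]) (auto simp: L_iff)
    show "\<exists>w'\<in>W. \<forall>B\<in>FX. \<forall>z\<in>Y. L w' B z \<longleftrightarrow> L w B z \<or> B = A \<and> z = y"
      if "w \<in> W" "A \<in> FX" "y \<in> Y" for w A y
      using D.ins[of "A @ y" w] that T_iff[of A y] F.length_Z
      by (intro bexI[of _ "D.ins (A @ y) w"]) (auto simp: L_iff)
  qed
  have gr_iff: "gr \<gamma> ps x v \<longleftrightarrow> v = g x"
    if "defined_by M \<gamma> ps (n + m) (fun_graph X g)" "x \<in> X" "v \<in> Y" for \<gamma> ps g x v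
  proof -
    have "x @ v \<in> fun_graph X g \<longleftrightarrow> gr \<gamma> ps x v"
      using that F.length_X len_Y by (simp add: defined_by_def gr_def)
    then show ?thesis using that F.length_X by (auto simp: fun_graph_def)
  qed
  have hr_iff: "hr \<eta> qs u v y \<longleftrightarrow> y = h u v"
    if "defined_by M \<eta> qs (m + m + m) (op_graph Y h)" "u \<in> Y" "v \<in> Y" "y \<in> Y" for \<eta> qs h u v y
  proof -
    have "u @ v @ y \<in> op_graph Y h \<longleftrightarrow> hr \<eta> qs u v y"
      using that len_Y by (simp add: defined_by_def hr_def)
    then show ?thesis using that len_Y by (auto simp: op_graph_def)
  qed
  have solvable: "\<exists>G. recursive_solution M X k FX E m Y y0 g h G \<and>
      fun_graph FX G = {A @ y | A y. A \<in> FX \<and> y \<in> Y \<and>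
        derivations.derivable X FX E Y W L (gr \<gamma>) (hr \<eta>) y0 ps qs A y}"
    if "y0 \<in> Y" "g \<in> X \<rightarrow> Y" "defined_by M \<gamma> ps (n + m) (fun_graph X g)"
      "h \<in> Y \<rightarrow> Y \<rightarrow> Y" "defined_by M \<eta> qs (m + m + m) (op_graph Y h)" "comm_assoc_on Y h"
    for y0 g h \<gamma> \<eta> ps qs
  proof -
    interpret derivations M n k X FX E "set es" m l "length ps" "length qs" Y W L "gr \<gamma>" "hr \<eta>"
      using that(3,5) unfolding defined_by_def by (intro deriv) (elim conjE, assumption)+
    show ?thesis
      by (rule solution[OF that(1,2,4,6) refl refl gr_iff[OF that(3)] hr_iff[OF that(5)]])
         (assumption+, intro exI conjI)
  qed
  note unique = F.recursive_solution_unique[OF assms(3)]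
  show ?thesis
  proof (intro conjI allI impI exI[of _ es])
    fix y0 g h
    assume "y0 \<in> Y \<and> g \<in> X \<rightarrow> Y \<and> definable M (n + m) (fun_graph X g) \<and>
      h \<in> Y \<rightarrow> Y \<rightarrow> Y \<and> definable M (m + m + m) (op_graph Y h) \<and> comm_assoc_on Y h"
    then have "\<exists>G. recursive_solution M X k FX E m Y y0 g h G"
      unfolding definable_def using solvable by blast
    then show "\<exists>!G. recursive_solution M X k FX E m Y y0 g h G"
      using unique by blast
  next
    fix \<gamma> \<eta> :: "('f, 'r) fm" and p q :: nat
    show "\<exists>\<Gamma> :: ('f, 'r) fm. \<forall>y0 g h ps qs G.
          length ps = p \<and> length qs = q \<and> y0 \<in> Y \<and>
          g \<in> X \<rightarrow> Y \<and> defined_by M \<gamma> ps (n + m) (fun_graph X g) \<and>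
          h \<in> Y \<rightarrow> Y \<rightarrow> Y \<and> defined_by M \<eta> qs (m + m + m) (op_graph Y h) \<and> comm_assoc_on Y h \<and>
          recursive_solution M X k FX E m Y y0 g h G
          \<longrightarrow> defined_by M \<Gamma> (y0 @ ps @ qs @ es) (k + m) (fun_graph FX G)"
    proof (cases "wf_fm M \<gamma> \<and> fv \<gamma> \<subseteq> {..<n + m + p} \<and> wf_fm M \<eta> \<and> fv \<eta> \<subseteq> {..<m + m + m + q}")
      case True
      then interpret derivations M n k X FX E "set es" m l p q Y W L "gr \<gamma>" "hr \<eta>"
        by (intro deriv) simp_all
      obtain \<Gamma> where \<Gamma>: "\<And>y0 ps qs. y0 \<in> Y \<Longrightarrow> length ps = p \<Longrightarrow> length qs = q \<Longrightarrow>
          defined_by M \<Gamma> (y0 @ ps @ qs @ es) (k + m)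
            {A @ y | A y. A \<in> FX \<and> y \<in> Y \<and> derivable y0 ps qs A y}"
        by (rule uniform_formula[OF order_refl]) (rule that)
      show ?thesis
      proof (intro exI[of _ \<Gamma>] allI impI, elim conjE)
        fix y0 g h ps qs G
        assume *: "length ps = p" "length qs = q" "y0 \<in> Y" "g \<in> X \<rightarrow> Y"
          "defined_by M \<gamma> ps (n + m) (fun_graph X g)" "h \<in> Y \<rightarrow> Y \<rightarrow> Y"
          "defined_by M \<eta> qs (m + m + m) (op_graph Y h)" "comm_assoc_on Y h"
          and G: "recursive_solution M X k FX E m Y y0 g h G"
        obtain G' where G': "recursive_solution M X k FX E m Y y0 g h G'"
          "fun_graph FX G' = {A @ y | A y. A \<in> FX \<and> y \<in> Y \<and> derivable y0 ps qs A y}"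
          using solvable[OF *(3-8)] by (elim exE conjE)
        show "defined_by M \<Gamma> (y0 @ ps @ qs @ es) (k + m) (fun_graph FX G)"
          using \<Gamma>[OF *(3,1,2)] G'(2) unique[OF G G'(1)] by simp
      qed
    next
      case False
      \<comment> \<open>With parameter tuples of these lengths, \<open>\<gamma>\<close> or \<open>\<eta>\<close> does not define any graph.\<close>
      then show ?thesis by (auto simp: defined_by_def)
    qed
  qed
qed

end
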